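(* Let $\mathbf{R}=\langle R,+,\cdot,\alpha,0,1\rangle$ be a Łukasiewicz semiring and let $x\oplus y=\alpha\big((\alpha(x)+y)\cdot\alpha(y)\big)$ for $x,y\in R$. Then $\mathbf{M}(\mathbf{R})=\langle R,\oplus,\alpha,0\rangle$ (with $\alpha$ playing the role of $'$) is an MV-algebra.
   Context: An MV-algebra is an algebra $\langle M,\oplus,{}',0\rangle$ of type $\langle 2,1,0\rangle$ such that $\langle M,\oplus,0\rangle$ is a commutative monoid, $x''=x$, $x\oplus 0'=0'$, and $(x'\oplus y)'\oplus y=(y'\oplus x)'\oplus x$. A semiring is an algebra $\langle R,+,\cdot,0,1\rangle$ such that $\langle R,+,0\rangle$ is a commutative monoid, $\langle R,\cdot,1\rangle$ is a monoid, both distributive laws $(x+y)\cdot z=(x\cdot z)+(y\cdot z)$ and $x\cdot(y+z)=(x\cdot y)+(x\cdot z)$ hold, and $x\cdot 0=0\cdot x=0$. If $x+x=x$ holds (idempotency), then $x\le y$ iff $x+y=y$ defines a partial order. A Łukasiewicz semiring is an idempotent semiring (multiplication is not assumed commutative) together with a map $\alpha:R\to R$ such that $\alpha(\alpha(x))=x$; $x\le y$ implies $\alpha(y)\le\alpha(x)$; and $\alpha(x\cdot\alpha(y))\cdot\alpha(y)=\alpha(y\cdot\alpha(x))\cdot\alpha(x)$ for all $x,y$. *)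

theory Defs
  imports "HOL-Algebra.Ring"
begin

locale mv_algebra =
  fixes M :: "'a set"
    and plus :: "'a \<Rightarrow> 'a \<Rightarrow> 'a"  (infixl "\<boxplus>" 65)
    and neg :: "'a \<Rightarrow> 'a"
    and zero :: 'a
  assumes comm_monoid: "comm_monoid \<lparr>carrier = M, monoid.mult = plus, one = zero\<rparr>"
    and neg_closed: "x \<in> M \<Longrightarrow> neg x \<in> M"
    and neg_neg: "x \<in> M \<Longrightarrow> neg (neg x) = x"
    and plus_neg_zero: "x \<in> M \<Longrightarrow> x \<boxplus> neg zero = neg zero"
    and lukasiewicz: "\<lbrakk>x \<in> M; y \<in> M\<rbrakk> \<Longrightarrow>
      neg (neg x \<boxplus> y) \<boxplus> y = neg (neg y \<boxplus> x) \<boxplus> x"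

locale idempotent_semiring = semiring +
  assumes add_idem: "x \<in> carrier R \<Longrightarrow> x \<oplus> x = x"

definition semiring_le :: "('a, 'm) ring_scheme \<Rightarrow> 'a \<Rightarrow> 'a \<Rightarrow> bool"
  where "semiring_le R x y \<longleftrightarrow> x \<oplus>\<^bsub>R\<^esub> y = y"

(* The involution is constrained on the carrier only. *)
locale lukasiewicz_semiring = idempotent_semiring R
  for R :: "('a, 'm) ring_scheme" (structure) +
  fixes \<alpha> :: "'a \<Rightarrow> 'a"
  assumes inv_closed: "x \<in> carrier R \<Longrightarrow> \<alpha> x \<in> carrier R"
    and inv_inv: "x \<in> carrier R \<Longrightarrow> \<alpha> (\<alpha> x) = x"
    and inv_antitone: "\<lbrakk>x \<in> carrier R; y \<in> carrier R; semiring_le R x y\<rbrakk>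
      \<Longrightarrow> semiring_le R (\<alpha> y) (\<alpha> x)"
    and lukasiewicz: "\<lbrakk>x \<in> carrier R; y \<in> carrier R\<rbrakk> \<Longrightarrow>
      \<alpha> (x \<otimes> \<alpha> y) \<otimes> \<alpha> y = \<alpha> (y \<otimes> \<alpha> x) \<otimes> \<alpha> x"

definition mv_plus :: "('a, 'm) ring_scheme \<Rightarrow> ('a \<Rightarrow> 'a) \<Rightarrow> 'a \<Rightarrow> 'a \<Rightarrow> 'a"
  where "mv_plus R \<alpha> x y = \<alpha> ((\<alpha> x \<oplus>\<^bsub>R\<^esub> y) \<otimes>\<^bsub>R\<^esub> \<alpha> y)"

end

(* The Lukasiewicz identity at (1, 0) gives \<alpha> 0 \<cdot> \<alpha> 1 = 0, so \<alpha> 1 = 0 and 1 is the top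
   element; at (1, x) it then gives x \<cdot> \<alpha> x = 0. Hence multiplication is decreasing and
   x \<oplus> y = \<alpha> (\<alpha> x \<cdot> \<alpha> y). What remains is commutativity.
   For a = y \<cdot> x we have \<alpha> a \<cdot> y \<cdot> x = 0, hence x \<le> \<alpha> (\<alpha> a \<cdot> y), and multiplying by y
   on the right gives x \<cdot> y \<le> \<alpha> (\<alpha> a \<cdot> y) \<cdot> y = \<alpha> (\<alpha> y \<cdot> a) \<cdot> a \<le> a. *)
theory Submission imports Defs begin

context idempotent_semiring
begin

abbreviation le (infix "\<preceq>" 50)
  where "x \<preceq> y \<equiv> semiring_le R x y"

lemma le_antisym:
  assumes "x \<in> carrier R" "y \<in> carrier R" "x \<preceq> y" "y \<preceq> x"
  shows "x = y"
  using assms a_comm[of x y] by (simp add: semiring_le_def)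

lemma le_trans:
  assumes "x \<in> carrier R" "y \<in> carrier R" "z \<in> carrier R" "x \<preceq> y" "y \<preceq> z"
  shows "x \<preceq> z"
  using assms a_assoc[of x y z] by (simp add: semiring_le_def)

lemma zero_le: "x \<in> carrier R \<Longrightarrow> \<zero> \<preceq> x"
  by (simp add: semiring_le_def)

lemma mult_right_mono:
  assumes "x \<in> carrier R" "y \<in> carrier R" "z \<in> carrier R" "x \<preceq> y"
  shows "x \<otimes> z \<preceq> y \<otimes> z"
  using assms l_distr[of x y z] by (simp add: semiring_le_def)

end

context lukasiewicz_semiring
begin

text \<open>Applying \<alpha> to 0 \<le> \<alpha> x reverses it. A top element is thus available
  before it is identified with 1.\<close>

lemma le_inv_zero:
  assumes "x \<in> carrier R"
  shows "x \<preceq> \<alpha> \<zero>"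
  using inv_antitone[of \<zero> "\<alpha> x"] assms by (simp add: zero_le inv_closed inv_inv)

lemma inv_one: "\<alpha> \<one> = \<zero>"
proof -
  have "\<alpha> \<zero> \<otimes> \<alpha> \<one> = \<zero>"
    using lukasiewicz[of \<one> \<zero>] by (simp add: inv_closed inv_inv)
  \<comment> \<open>Multiplying 1 \<le> \<alpha> 0 by \<alpha> 1 puts \<alpha> 1 below the product
    just shown to be 0.\<close>
  moreover have "\<one> \<otimes> \<alpha> \<one> \<preceq> \<alpha> \<zero> \<otimes> \<alpha> \<one>"
    by (intro mult_right_mono le_inv_zero) (simp_all add: inv_closed)
  ultimately show ?thesis
    by (simp add: semiring_le_def inv_closed)
qed

lemma inv_zero: "\<alpha> \<zero> = \<one>"
  using inv_inv[of \<one>] by (simp add: inv_one)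

lemma le_one: "x \<in> carrier R \<Longrightarrow> x \<preceq> \<one>"
  using le_inv_zero[of x] by (simp add: inv_zero)

lemma mult_le_right:
  assumes "x \<in> carrier R" "y \<in> carrier R"
  shows "x \<otimes> y \<preceq> y"
  using mult_right_mono[of x \<one> y] assms by (simp add: le_one)

lemma mult_inv_right:
  assumes "x \<in> carrier R"
  shows "x \<otimes> \<alpha> x = \<zero>"
  using lukasiewicz[of \<one> x] assms by (simp add: inv_closed inv_inv inv_one)

lemma mult_inv_left:
  assumes "x \<in> carrier R"
  shows "\<alpha> x \<otimes> x = \<zero>"
  using mult_inv_right[of "\<alpha> x"] assms by (simp add: inv_closed inv_inv)

text \<open>When x y = 0, the left side of the Lukasiewicz identity at (x, \<alpha> y) is \<alpha> 0
  y = y, so y is a left multiple of \<alpha> x and hence lies below it.\<close>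

lemma le_inv_if_mult_eq_zero:
  assumes "x \<in> carrier R" "y \<in> carrier R" "x \<otimes> y = \<zero>"
  shows "y \<preceq> \<alpha> x"
proof -
  have "y = \<alpha> (\<alpha> y \<otimes> \<alpha> x) \<otimes> \<alpha> x"
    using lukasiewicz[of x "\<alpha> y"] assms by (simp add: inv_closed inv_inv inv_zero)
  then show ?thesis
    using mult_le_right[of "\<alpha> (\<alpha> y \<otimes> \<alpha> x)" "\<alpha> x"] assms by (simp add: inv_closed)
qed

lemma mult_le_commute:
  assumes x: "x \<in> carrier R" and y: "y \<in> carrier R"
  shows "x \<otimes> y \<preceq> y \<otimes> x"
proof -
  define a where "a = y \<otimes> x"
  have a: "a \<in> carrier R" using x y by (simp add: a_def)
  have "(\<alpha> a \<otimes> y) \<otimes> x = \<zero>"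
    using x y a mult_inv_left[OF a] by (simp add: m_assoc inv_closed flip: a_def)
  then have "x \<preceq> \<alpha> (\<alpha> a \<otimes> y)"
    using x y a by (intro le_inv_if_mult_eq_zero) (simp_all add: inv_closed)
  then have "x \<otimes> y \<preceq> \<alpha> (\<alpha> a \<otimes> y) \<otimes> y"
    using x y a by (intro mult_right_mono) (simp_all add: inv_closed)
  also have "\<alpha> (\<alpha> a \<otimes> y) \<otimes> y = \<alpha> (\<alpha> y \<otimes> a) \<otimes> a"
    using lukasiewicz[of "\<alpha> a" "\<alpha> y"] y a by (simp add: inv_closed inv_inv)
  finally have "x \<otimes> y \<preceq> \<alpha> (\<alpha> y \<otimes> a) \<otimes> a" .
  moreover have "\<alpha> (\<alpha> y \<otimes> a) \<otimes> a \<preceq> a"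
    using y a by (intro mult_le_right) (simp_all add: inv_closed)
  ultimately have "x \<otimes> y \<preceq> a"
    using x y a by (intro le_trans[of "x \<otimes> y" "\<alpha> (\<alpha> y \<otimes> a) \<otimes> a" a]) (simp_all add: inv_closed)
  then show ?thesis by (simp add: a_def)
qed

lemma mult_commute:
  assumes "x \<in> carrier R" "y \<in> carrier R"
  shows "x \<otimes> y = y \<otimes> x"
  using assms by (intro le_antisym mult_le_commute) simp_all

text \<open>Right distributivity leaves the extra summand y \<alpha> y, which is 0.\<close>

lemma mv_plus_eq:
  assumes "x \<in> carrier R" "y \<in> carrier R"
  shows "mv_plus R \<alpha> x y = \<alpha> (\<alpha> x \<otimes> \<alpha> y)"
  using assms by (simp add: mv_plus_def l_distr mult_inv_right inv_closed)

lemma mv_plus_closed: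
  assumes "x \<in> carrier R" "y \<in> carrier R"
  shows "mv_plus R \<alpha> x y \<in> carrier R"
  using assms by (simp add: mv_plus_eq inv_closed)

text \<open>The involution \<alpha> carries \<open>mv_plus\<close> to multiplication and 0 to 1, so
  the laws are those of the now commutative multiplicative monoid.\<close>

lemma comm_monoid_mv_plus:
  "comm_monoid \<lparr>carrier = carrier R, monoid.mult = mv_plus R \<alpha>, one = \<zero>\<rparr>"
  by (rule comm_monoidI)
    (simp_all add: mv_plus_closed, simp_all add: mv_plus_eq inv_closed inv_inv inv_zero m_assoc
      mult_commute[of "\<alpha> _" "\<alpha> _"])

lemma mv_algebra_mv_plus: "mv_algebra (carrier R) (mv_plus R \<alpha>) \<alpha> \<zero>"
proof (rule mv_algebra.intro)
  fix x y assume "x \<in> carrier R" "y \<in> carrier R"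
  then show "mv_plus R \<alpha> (\<alpha> (mv_plus R \<alpha> (\<alpha> x) y)) y =
      mv_plus R \<alpha> (\<alpha> (mv_plus R \<alpha> (\<alpha> y) x)) x"
    \<comment> \<open>By \<open>mv_plus_eq\<close> the left side is \<alpha> (\<alpha> (x \<alpha>
      y) \<alpha> y), so the equation is \<alpha> applied to the Lukasiewicz identity.\<close>
    using lukasiewicz[of x y] by (simp add: mv_plus_eq inv_closed inv_inv)
qed (simp_all add: comm_monoid_mv_plus mv_plus_eq inv_closed inv_inv inv_zero inv_one)

end

theorem corollary4:
  fixes R :: "('a, 'm) ring_scheme" and \<alpha> :: "'a \<Rightarrow> 'a"
  assumes "lukasiewicz_semiring R \<alpha>"
  shows "mv_algebra (carrier R) (mv_plus R \<alpha>) \<alpha> \<zero>\<^bsub>R\<^esub>"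
  using assms by (rule lukasiewicz_semiring.mv_algebra_mv_plus)

end
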